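(* Let $A\in\mathbb{R}^{n\times n}$ be Hurwitz, $B\in\mathbb{R}^{n\times m}$, $C\in\mathbb{R}^{p\times n}$, and let the matrices $P,\alpha_j,\beta_j,\gamma_j,\rho_j$ be as defined in the context. Suppose that the pairs $(A,B)$, $(A,PC^{\mathrm T})$ and $(A,\gamma_j\rho_j)$, for all $j\in\mathbb{N}$, are controllable. Then the powers of the spectral density $S=FF^\sim$ are related to the system $E$ and its conjugate $E^\sim$ by $$S^k=C\,\overrightarrow{\prod_{j=1}^{k}}\big(\alpha_j^{\mathrm T}E^\sim\big)\ \beta_k\ \overleftarrow{\prod_{j=1}^{k}}\big(E\alpha_j\big)\,C^{\mathrm T},\qquad k\in\mathbb{N},$$ as an identity of rational matrix-valued functions of $s\in\mathbb{C}$.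
   Context: Transfer functions: $E(s):=(sI_n-A)^{-1}$, $E^\sim(s):=E(-\overline{s})^*=-(sI_n+A^{\mathrm T})^{-1}$, $F(s):=CE(s)B$, $F^\sim(s):=F(-\overline s)^*=B^{\mathrm T}E^\sim(s)C^{\mathrm T}$, and $S(s):=F(s)F^\sim(s)$ (so $S(i\omega)=F(i\omega)F(i\omega)^*$). Ordered products: $\overrightarrow{\prod}_{j=1}^kX_j:=X_1X_2\cdots X_k$ (rightwards) and $\overleftarrow{\prod}_{j=1}^kX_j:=X_k\cdots X_2X_1$ (leftwards). Notation: $\mathbb{N}$ is the set of positive integers, $\mho:=BB^{\mathrm T}$, $\Omega:=C^{\mathrm T}C$, $\delta_{jk}$ is the Kronecker delta, so that $\Omega^{\delta_{j1}}$ equals $\Omega$ if $j=1$ and $I_n$ otherwise. For the Hurwitz matrix $A$, the operator $\mathcal{L}_A(V):=\int_0^\infty e^{tA}Ve^{tA^{\mathrm T}}dt$ gives the unique solution $X$ of $AX+XA^{\mathrm T}+V=0$. The matrix $P:=\mathcal{L}_A(\mho)$ is the controllability Gramian of $(A,B)$. Recursion: $\alpha_1:=\gamma_0:=P$, $\beta_0:=I_n$, $\beta_1:=P^{-1}\mho P^{-1}$, and for $j\in\mathbb{N}$, $$\gamma_j=\mathcal{L}_A(\alpha_j\Omega^{\delta_{j1}}\gamma_{j-1}),\qquad \alpha_{j+1}=\gamma_j\beta_j,\qquad \beta_{j+1}=\gamma_j^{-1}\alpha_j\Omega^{\delta_{j1}}\gamma_{j-1}\gamma_j^{-1}.$$ The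 matrices $\beta_j$ are factorised as $\beta_j=\rho_j\rho_j^{\mathrm T}$, with real matrices $\rho_j$ defined by $\rho_1:=P^{-1}B$, $\rho_2:=\gamma_1^{-1}PC^{\mathrm T}$, and $\rho_{j+1}=\gamma_j^{-1}\gamma_{j-1}\rho_{j-1}$ for $j\geqslant2$. The controllability condition in the claim is understood inductively along this recursion; it is equivalent to $\det\gamma_j\neq0$ for all $j\geqslant0$, which makes all the inverses above well defined. *)

theory Defs
  imports "HOL-Analysis.Analysis"
begin

text \<open>
  Multiplication \<open>*\<close> of vectors of vectors is componentwise, so powers and the exponential with
  respect to the matrix product \<open>**\<close> are defined here.
\<close>

primrec mpow :: "'a::semiring_1^'n^'n \<Rightarrow> nat \<Rightarrow> 'a^'n^'n" where
  "mpow M 0 = mat 1"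
| "mpow M (Suc k) = M ** mpow M k"

definition mexp :: "real^'n^'n \<Rightarrow> real^'n^'n" where
  "mexp M = (\<Sum>k. (1 / fact k) *\<^sub>R mpow M k)"

primrec prod_right :: "(nat \<Rightarrow> 'a::semiring_1^'n^'n) \<Rightarrow> nat \<Rightarrow> 'a^'n^'n" where
  "prod_right X 0 = mat 1"
| "prod_right X (Suc k) = prod_right X k ** X (Suc k)"

primrec prod_left :: "(nat \<Rightarrow> 'a::semiring_1^'n^'n) \<Rightarrow> nat \<Rightarrow> 'a^'n^'n" where
  "prod_left X 0 = mat 1"
| "prod_left X (Suc k) = X (Suc k) ** prod_left X k"

abbreviation cmat :: "real^'m^'n \<Rightarrow> complex^'m^'n" where
  "cmat \<equiv> map_matrix complex_of_real"

definition adjoint_mat :: "complex^'m^'n \<Rightarrow> complex^'n^'m" where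
  "adjoint_mat M = map_matrix cnj (transpose M)"

definition hurwitz :: "real^'n^'n \<Rightarrow> bool" where
  "hurwitz A \<longleftrightarrow> (\<forall>z::complex. \<forall>v. v \<noteq> 0 \<and> cmat A *v v = z *s v \<longrightarrow> Re z < 0)"

text \<open>
  Controllability of a pair \<open>(A, B)\<close>: the block matrix \<open>[B, A B, \<dots>, A^(n-1) B]\<close> has rank \<open>n\<close>.
  The rank is taken as the dimension of the span of the columns of the blocks.
\<close>

definition controllable :: "real^'n^'n \<Rightarrow> real^'m^'n \<Rightarrow> bool" where
  "controllable A B \<longleftrightarrow> dim (\<Union>k<CARD('n). columns (mpow A k ** B)) = CARD('n)"

definition lyap :: "real^'n^'n \<Rightarrow> real^'n^'n \<Rightarrow> real^'n^'n" where
  "lyap A V = integral {0..} (\<lambda>t. mexp (t *\<^sub>R A) ** V ** mexp (t *\<^sub>R transpose A))"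

definition gramian :: "real^'n^'n \<Rightarrow> real^'m^'n \<Rightarrow> real^'n^'n" where
  "gramian A B = lyap A (B ** transpose B)"

text \<open>
  The sequences \<open>\<beta>\<close> and \<open>\<gamma>\<close> start at index 0 and \<open>\<alpha>\<close> at index 1; the value \<open>\<alpha>\<^sub>0 = 0\<close> is a dummy
  on which nothing else depends.
\<close>

function (sequential)
  alpha_seq :: "real^'n^'n \<Rightarrow> real^'m^'n \<Rightarrow> real^'n^'p \<Rightarrow> nat \<Rightarrow> real^'n^'n" and
  beta_seq :: "real^'n^'n \<Rightarrow> real^'m^'n \<Rightarrow> real^'n^'p \<Rightarrow> nat \<Rightarrow> real^'n^'n" and
  gamma_seq :: "real^'n^'n \<Rightarrow> real^'m^'n \<Rightarrow> real^'n^'p \<Rightarrow> nat \<Rightarrow> real^'n^'n"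
where
  "alpha_seq A B C 0 = 0"
| "alpha_seq A B C (Suc 0) = gramian A B"
| "alpha_seq A B C (Suc (Suc j)) = gamma_seq A B C (Suc j) ** beta_seq A B C (Suc j)"
| "beta_seq A B C 0 = mat 1"
| "beta_seq A B C (Suc 0) =
     matrix_inv (gramian A B) ** (B ** transpose B) ** matrix_inv (gramian A B)"
| "beta_seq A B C (Suc (Suc j)) =
     matrix_inv (gamma_seq A B C (Suc j)) ** alpha_seq A B C (Suc j)
       ** (if Suc j = 1 then transpose C ** C else mat 1)
       ** gamma_seq A B C j ** matrix_inv (gamma_seq A B C (Suc j))"
| "gamma_seq A B C 0 = gramian A B"
| "gamma_seq A B C (Suc j) =
     lyap A (alpha_seq A B C (Suc j) ** (if Suc j = 1 then transpose C ** C else mat 1)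
       ** gamma_seq A B C j)"
  by pat_completeness auto
termination
  by (relation "Wellfounded.measure (\<lambda>x. case x of
        Inl (_, _, _, j) \<Rightarrow> 2 * j
      | Inr (Inl (_, _, _, j)) \<Rightarrow> 2 * j
      | Inr (Inr (_, _, _, j)) \<Rightarrow> Suc (2 * j))") auto

text \<open>
  The matrices \<open>\<rho>\<^sub>j\<close> have as many columns as \<open>B\<close> for odd \<open>j\<close> and as \<open>C\<^sup>T\<close> for even \<open>j\<close>, and the
  recursion \<open>\<rho>\<^sub>j\<^sub>+\<^sub>2 = \<gamma>\<^sub>j\<^sub>+\<^sub>1\<^sup>-\<^sup>1 \<gamma>\<^sub>j \<rho>\<^sub>j\<close> preserves the parity of \<open>j\<close>. They are therefore given by two functions:
  \<open>rho_odd\<close> is meaningful at odd \<open>j\<close>, \<open>rho_even\<close> at even \<open>j \<ge> 2\<close>. The values at other indices are dummies.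
\<close>

fun rho_odd :: "real^'n^'n \<Rightarrow> real^'m^'n \<Rightarrow> real^'n^'p \<Rightarrow> nat \<Rightarrow> real^'m^'n" where
  "rho_odd A B C 0 = 0"
| "rho_odd A B C (Suc 0) = matrix_inv (gramian A B) ** B"
| "rho_odd A B C (Suc (Suc j)) =
     matrix_inv (gamma_seq A B C (Suc j)) ** gamma_seq A B C j ** rho_odd A B C j"

fun rho_even :: "real^'n^'n \<Rightarrow> real^'m^'n \<Rightarrow> real^'n^'p \<Rightarrow> nat \<Rightarrow> real^'p^'n" where
  "rho_even A B C 0 = 0"
| "rho_even A B C (Suc 0) = 0"
| "rho_even A B C (Suc (Suc 0)) =
     matrix_inv (gamma_seq A B C 1) ** gramian A B ** transpose C"
| "rho_even A B C (Suc (Suc (Suc j))) =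
     matrix_inv (gamma_seq A B C (Suc (Suc j))) ** gamma_seq A B C (Suc j)
       ** rho_even A B C (Suc j)"

definition resolvent :: "real^'n^'n \<Rightarrow> complex \<Rightarrow> complex^'n^'n" where
  "resolvent A s = matrix_inv (mat s - cmat A)"

definition transfer :: "real^'n^'n \<Rightarrow> real^'m^'n \<Rightarrow> real^'n^'p \<Rightarrow> complex \<Rightarrow> complex^'m^'p" where
  "transfer A B C s = cmat C ** resolvent A s ** cmat B"

definition sys_conj :: "(complex \<Rightarrow> complex^'m^'n) \<Rightarrow> complex \<Rightarrow> complex^'n^'m" where
  "sys_conj G s = adjoint_mat (G (- cnj s))"

definition spectral_density ::
    "real^'n^'n \<Rightarrow> real^'m^'n \<Rightarrow> real^'n^'p \<Rightarrow> complex \<Rightarrow> complex^'p^'p" where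
  "spectral_density A B C s = transfer A B C s ** sys_conj (transfer A B C) s"

end

theory Submission
  imports Defs "HOL-Computational_Algebra.Fundamental_Theorem_Algebra"
begin

text \<open>
  If \<open>A X + X A\<^sup>T + V = 0\<close> with \<open>X\<close> invertible, then
  \<open>E V E\<^sup>~ = E X + X E\<^sup>~ = X E\<^sup>~ (X\<^sup>-\<^sup>1 V X\<^sup>-\<^sup>1) E X\<close>, so \<open>E\<close> and \<open>E\<^sup>~\<close> can be exchanged. With
  \<open>X = \<gamma>\<^sub>j\<close> the middle factor is \<open>\<beta>\<^sub>j\<^sub>+\<^sub>1\<close>. Applying this repeatedly to the claimed factorisation of
  \<open>S\<^sup>k\<^sup>+\<^sup>1\<close> carries a factor \<open>S\<close> through the left product to the right end and leaves \<open>S\<^sup>k S\<close>.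

  The Lyapunov equation for \<open>\<gamma>\<^sub>j\<close> needs exponential decay of the flow of a Hurwitz matrix, obtained by
  induction on the degree of a polynomial annihilating the initial vector. The invertibility of \<open>\<gamma>\<^sub>j\<^sub>+\<^sub>1\<close>
  follows from controllability, since by \<open>\<beta>\<^sub>j = \<rho>\<^sub>j \<rho>\<^sub>j\<^sup>T\<close> it is the Gramian of \<open>(A, \<gamma>\<^sub>j \<rho>\<^sub>j)\<close>.
\<close>

subsection \<open>The matrix exponential\<close>

lemma bounded_bilinear_matrix_mul:
  "bounded_bilinear ((**) :: real^'n^'m \<Rightarrow> real^'p^'n \<Rightarrow> real^'p^'m)"
  unfolding bilinear_conv_bounded_bilinear[symmetric] bilinear_def
  by (auto intro!: linearI simp: vec_eq_iff matrix_matrix_mult_def sum.distrib sum_distrib_left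
      algebra_simps)

lemma bounded_linear_transpose: "bounded_linear (transpose :: real^'n^'m \<Rightarrow> real^'m^'n)"
  unfolding linear_conv_bounded_linear[symmetric]
  by (auto intro!: linearI simp: vec_eq_iff transpose_def)

lemma map_matrix_of_real_mult: "cmat (X ** Y) = cmat X ** cmat Y"
  by (simp add: vec_eq_iff matrix_matrix_mult_def)

lemma mpow_Suc2: "mpow M (Suc k) = mpow M k ** M"
  by (induction k) (simp_all add: matrix_mul_assoc)

lemma mpow_transpose: "mpow (transpose M) k = transpose (mpow (M :: 'a::comm_semiring_1^'n^'n) k)"
proof (induction k)
  case (Suc k)
  then show ?case by (simp only: mpow_Suc2[of M]) (simp add: matrix_transpose_mul)
qed simp

lemma mpow_scaleR: "mpow (t *\<^sub>R M) k = t ^ k *\<^sub>R mpow (M :: real^'n^'n) k"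
  by (induction k)
     (simp_all add: vec_eq_iff matrix_matrix_mult_def sum_distrib_left algebra_simps)

lemma has_vector_derivative_vec:
  fixes f :: "real \<Rightarrow> 'a::euclidean_space^'n"
  assumes "\<And>i. ((\<lambda>t. f t $ i) has_vector_derivative f' $ i) (at x within S)"
  shows "(f has_vector_derivative f') (at x within S)"
proof -
  have "((\<lambda>t. f t $ i \<bullet> u) has_derivative (\<lambda>h. (h *\<^sub>R f' $ i) \<bullet> u)) (at x within S)" for i u
    using assms[of i] unfolding has_vector_derivative_def by (rule has_derivative_inner_left)
  then show ?thesis
    unfolding has_vector_derivative_def has_derivative_componentwise_within[of f]
    by (auto simp: Basis_vec_def inner_axis)
qed

text \<open>The constant is the sum of all absolute entries of \<open>A\<close>. It dominates every
  absolute row sum, so each further factor \<open>A\<close> costs at most one factor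
  \<open>K\<close>.\<close>

lemma mpow_entry_bound:
  fixes A :: "real^'n^'n"
  obtains K where "\<And>k i j. \<bar>mpow A k $ i $ j\<bar> \<le> K ^ k"
proof -
  define K where "K = (\<Sum>i\<in>UNIV. \<Sum>j\<in>UNIV. \<bar>A $ i $ j\<bar>)"
  have row: "(\<Sum>l\<in>UNIV. \<bar>A $ i $ l\<bar>) \<le> K" for i
    unfolding K_def by (rule member_le_sum[of i UNIV]) (auto intro: sum_nonneg)
  have "\<bar>mpow A k $ i $ j\<bar> \<le> K ^ k" for k i j
  proof (induction k arbitrary: i)
    case 0
    then show ?case by (simp add: mat_def)
  next
    case (Suc k)
    have "\<bar>mpow A (Suc k) $ i $ j\<bar> \<le> (\<Sum>l\<in>UNIV. \<bar>A $ i $ l\<bar> * \<bar>mpow A k $ l $ j\<bar>)"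
      by (simp add: matrix_matrix_mult_def abs_mult[symmetric])
    also have "\<dots> \<le> (\<Sum>l\<in>UNIV. \<bar>A $ i $ l\<bar> * K ^ k)"
      by (intro sum_mono mult_left_mono Suc.IH) auto
    also have "\<dots> \<le> K * K ^ k"
      using row[of i] Suc.IH[of i]
      by (simp add: sum_distrib_right[symmetric] mult_right_mono order_trans[OF abs_ge_zero])
    finally show ?case by simp
  qed
  then show ?thesis by (rule that)
qed

lemma summable_mpow_entry:
  fixes A :: "real^'n^'n"
  shows "summable (\<lambda>k. (mpow A k $ i $ j / fact k) * t ^ k)"
proof -
  obtain K where K: "\<And>k i j. \<bar>mpow A k $ i $ j\<bar> \<le> K ^ k"
    using mpow_entry_bound[of A] by blast
  show ?thesis
  proof (rule summable_comparison_test'[where g = "\<lambda>k. inverse (fact k) * (K * \<bar>t\<bar>) ^ k"])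
    show "summable (\<lambda>k. inverse (fact k) * (K * \<bar>t\<bar>) ^ k)"
      by (rule summable_exp)
    show "norm (mpow A k $ i $ j / fact k * t ^ k) \<le> inverse (fact k) * (K * \<bar>t\<bar>) ^ k" for k
      using mult_right_mono[OF K[of k i j], of "\<bar>t\<bar> ^ k / fact k"]
      by (simp add: abs_mult power_abs power_mult_distrib field_simps)
  qed
qed

text \<open>The \<open>suminf\<close> in \<open>mexp\<close> carries no convergence by itself. It is
  supplied entry by entry, and each entry becomes a real power series in \<open>t\<close> that can
  be differentiated termwise.\<close>

lemma mexp_scaleR_sums:
  fixes A :: "real^'n^'n"
  shows "(\<lambda>k. (t ^ k / fact k) *\<^sub>R mpow A k) sums mexp (t *\<^sub>R A)"
    and mexp_entry: "mexp (t *\<^sub>R A) $ i $ j = (\<Sum>k. (mpow A k $ i $ j / fact k) * t ^ k)"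
proof -
  have "(\<lambda>k. (t ^ k / fact k) *\<^sub>R mpow A k) sums
      (\<chi> i j. \<Sum>k. (mpow A k $ i $ j / fact k) * t ^ k)"
    unfolding sums_def
    by (intro vec_tendstoI)
       (use summable_LIMSEQ[OF summable_mpow_entry] in \<open>simp add: field_simps\<close>)
  moreover from this have "mexp (t *\<^sub>R A) = (\<chi> i j. \<Sum>k. (mpow A k $ i $ j / fact k) * t ^ k)"
    by (simp add: mexp_def mpow_scaleR sums_iff)
  ultimately show "(\<lambda>k. (t ^ k / fact k) *\<^sub>R mpow A k) sums mexp (t *\<^sub>R A)"
    "mexp (t *\<^sub>R A) $ i $ j = (\<Sum>k. (mpow A k $ i $ j / fact k) * t ^ k)"
    by simp_all
qed

lemma mexp_commute:
  fixes A :: "real^'n^'n"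
  shows "mexp (t *\<^sub>R A) ** A = A ** mexp (t *\<^sub>R A)"
proof -
  interpret mul: bounded_bilinear "(**) :: real^'n^'n \<Rightarrow> real^'n^'n \<Rightarrow> real^'n^'n"
    by (rule bounded_bilinear_matrix_mul)
  have "(\<lambda>k. ((t ^ k / fact k) *\<^sub>R mpow A k) ** A) sums (mexp (t *\<^sub>R A) ** A)"
    by (rule bounded_linear.sums[OF mul.bounded_linear_left mexp_scaleR_sums(1)])
  moreover have "(\<lambda>k. A ** ((t ^ k / fact k) *\<^sub>R mpow A k)) sums (A ** mexp (t *\<^sub>R A))"
    by (rule bounded_linear.sums[OF mul.bounded_linear_right mexp_scaleR_sums(1)])
  moreover have "((t ^ k / fact k) *\<^sub>R mpow A k) ** A = A ** ((t ^ k / fact k) *\<^sub>R mpow A k)" for k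
    using mpow_Suc2[of A k] by (simp add: mul.scaleR_left mul.scaleR_right)
  ultimately show ?thesis
    by (simp add: sums_unique2)
qed

lemma mexp_0: "mexp (0 *\<^sub>R A) = mat 1"
  by (simp only: vec_eq_iff mexp_entry powser_zero) simp

lemma mexp_transpose: "mexp (t *\<^sub>R transpose A) = transpose (mexp (t *\<^sub>R A))"
  by (simp only: vec_eq_iff mexp_entry mpow_transpose) (simp add: transpose_def mexp_entry)

lemma mexp_has_vector_derivative:
  fixes A :: "real^'n^'n"
  shows "((\<lambda>t. mexp (t *\<^sub>R A)) has_vector_derivative mexp (t *\<^sub>R A) ** A) (at t within S)"
\<comment> \<open>The rule applies twice, first to rows and then to entries, which leaves a scalar
  power series.\<close>
proof (intro has_vector_derivative_vec)
  fix i j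
  let ?c = "\<lambda>j k. mpow A k $ i $ j / fact k"
  \<comment> \<open>Splitting the last factor off \<open>mpow A (Suc k)\<close> expresses the
    differentiated coefficients through row \<open>i\<close> of the series and column
    \<open>j\<close> of \<open>A\<close>.\<close>
  have "diffs (?c j) = (\<lambda>k. \<Sum>l\<in>UNIV. A $ l $ j * ?c l k)"
  proof
    fix k
    have "real (Suc k) * ?c j (Suc k) = mpow A (Suc k) $ i $ j / fact k"
      by (simp add: field_simps del: mpow.simps of_nat_Suc)
    then show "diffs (?c j) k = (\<Sum>l\<in>UNIV. A $ l $ j * ?c l k)"
      by (simp only: mpow_Suc2 diffs_def)
         (simp add: matrix_matrix_mult_def sum_divide_distrib mult.commute)
  qed
  then have "(\<Sum>k. diffs (?c j) k * t ^ k) = (\<Sum>k. \<Sum>l\<in>UNIV. A $ l $ j * (?c l k * t ^ k))"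
    by (simp add: sum_distrib_right mult.assoc)
  also have "\<dots> = (\<Sum>l\<in>UNIV. A $ l $ j * (\<Sum>k. ?c l k * t ^ k))"
    by (subst suminf_sum[OF summable_mult[OF summable_mpow_entry]])
       (simp only: suminf_mult[OF summable_mpow_entry])
  finally have "((\<lambda>t. mexp (t *\<^sub>R A) $ i $ j) has_field_derivative
      (mexp (t *\<^sub>R A) ** A) $ i $ j) (at t)"
    using termdiffs_strong_converges_everywhere[OF summable_mpow_entry, of A i j t]
    by (simp add: mexp_entry matrix_matrix_mult_def mult.commute)
  then show "((\<lambda>t. mexp (t *\<^sub>R A) $ i $ j) has_vector_derivative
      (mexp (t *\<^sub>R A) ** A) $ i $ j) (at t within S)"
    unfolding has_real_derivative_iff_has_vector_derivative
    by (rule has_vector_derivative_at_within)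
qed

subsection \<open>Decay of the flow of a Hurwitz matrix\<close>

text \<open>Variation of constants: the integrating factor \<open>exp (- l * t)\<close> removes the
  linear term, and the rest is integrated. Since \<open>c < - Re l\<close>, the bound on the
  integrand grows exponentially, so its integral is at most a multiple of its final value and the
  rate \<open>c\<close> of \<open>g\<close> survives.\<close>

lemma linear_decay_bound:
  fixes y g :: "real \<Rightarrow> complex^'n"
  assumes deriv: "\<And>t. t \<ge> 0 \<Longrightarrow> (y has_vector_derivative l *s y t + g t) (at t)"
    and g: "\<And>t. t \<ge> 0 \<Longrightarrow> norm (g t) \<le> M * exp (- c * t)"
    and c: "0 < c" "c < - Re l" and t: "t \<ge> 0"
  shows "norm (y t) \<le> (norm (y 0) + M / (- Re l - c)) * exp (- c * t)"
proof -
  define a where "a = - Re l"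
  have M: "M \<ge> 0"
    using g[of 0] by (auto intro: order_trans[OF norm_ge_zero])
  have norm_exp: "norm (exp (- l * of_real x) *s (v :: complex^'n)) = exp (a * x) * norm v" for x v
  proof -
    have "norm (exp (- l * of_real x) *s v) = norm (exp (- l * of_real x)) * norm v"
      by (simp add: norm_vec_def norm_mult L2_set_right_distrib)
    then show ?thesis
      by (simp add: a_def)
  qed
  define z where "z = (\<lambda>t. exp (- l * of_real t) *s y t)"
  have z: "(z has_vector_derivative exp (- l * of_real x) *s g x) (at x)" if "x \<ge> 0" for x
  proof (intro has_vector_derivative_vec)
    fix i
    have "((\<lambda>t. y t $ i) has_vector_derivative (l *s y x + g x) $ i) (at x)"
      by (rule bounded_linear.has_vector_derivative[OF bounded_linear_vec_nth deriv[OF that]])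
    moreover have "((\<lambda>t. exp (- l * of_real t)) has_vector_derivative - l * exp (- l * of_real x)) (at x)"
      by (auto intro!: derivative_eq_intros has_vector_derivative_real_field)
    ultimately have "((\<lambda>t. exp (- l * of_real t) * y t $ i) has_vector_derivative
        exp (- l * of_real x) * (l *s y x + g x) $ i + - l * exp (- l * of_real x) * y x $ i) (at x)"
      by (intro has_vector_derivative_mult)
    then show "((\<lambda>t. z t $ i) has_vector_derivative (exp (- l * of_real x) *s g x) $ i) (at x)"
      by (simp add: z_def algebra_simps)
  qed
  \<comment> \<open>A primitive of the bound on the norm of the derivative of
    \<open>z\<close>.\<close>
  define \<phi> where "\<phi> = (\<lambda>t. M / (a - c) * exp ((a - c) * t))"
  have \<phi>: "(\<phi> has_vector_derivative M * exp ((a - c) * x)) (at x)" for x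
    using c unfolding \<phi>_def a_def has_real_derivative_iff_has_vector_derivative[symmetric]
    by (auto intro!: derivative_eq_intros)
  have "norm (z t - z 0) \<le> \<phi> t - \<phi> 0"
  proof (cases "t = 0")
    case False
    show ?thesis
    proof (rule differentiable_bound_general)
      show "continuous_on {0..t} z"
        by (intro continuous_at_imp_continuous_on ballI has_vector_derivative_continuous[OF z]) auto
      show "continuous_on {0..t} \<phi>"
        by (intro continuous_at_imp_continuous_on ballI has_vector_derivative_continuous[OF \<phi>])
      show "norm (exp (- l * of_real x) *s g x) \<le> M * exp ((a - c) * x)" if "0 < x" for x
        using mult_left_mono[OF g[of x], of "exp (a * x)"] that unfolding norm_exp
        by (simp add: algebra_simps exp_diff exp_minus field_simps)
    qed (use z \<phi> t False in auto)
  qed simp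
  also have "\<dots> \<le> M / (a - c) * exp ((a - c) * t)"
    using c M by (simp add: \<phi>_def a_def)
  finally have "norm (z t) \<le> norm (y 0) + M / (a - c) * exp ((a - c) * t)"
    using norm_triangle_ineq2[of "z t" "z 0"] by (simp add: z_def)
  also have "\<dots> \<le> (norm (y 0) + M / (a - c)) * exp ((a - c) * t)"
    using c t mult_left_mono[of 1 "exp ((a - c) * t)" "norm (y 0)"]
    by (simp add: a_def distrib_right)
  finally have "exp (a * t) * norm (y t) \<le> (norm (y 0) + M / (a - c)) * exp ((a - c) * t)"
    by (simp only: z_def norm_exp)
  also have "\<dots> = exp (a * t) * ((norm (y 0) + M / (a - c)) * exp (- c * t))"
    by (simp add: exp_add[symmetric] algebra_simps)
  finally show ?thesis
    by (simp add: a_def)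
qed

section \<open>Polynomials in a matrix applied to a vector\<close>

definition poly_apply :: "complex^'n^'n \<Rightarrow> complex poly \<Rightarrow> complex^'n \<Rightarrow> complex^'n" where
  "poly_apply M p v = (\<Sum>i\<le>degree p. coeff p i *s (mpow M i *v v))"

lemma poly_apply_alt:
  assumes "degree p \<le> n"
  shows "poly_apply M p v = (\<Sum>i\<le>n. coeff p i *s (mpow M i *v v))"
  unfolding poly_apply_def
  by (rule sum.mono_neutral_left) (use assms in \<open>auto simp: coeff_eq_0 not_le\<close>)

lemma poly_apply_pCons: "poly_apply M (pCons a p) v = a *s v + M *v poly_apply M p v"
proof -
  have "poly_apply M (pCons a p) v = (\<Sum>i\<le>Suc (degree p). coeff (pCons a p) i *s (mpow M i *v v))"
    by (rule poly_apply_alt) (simp add: degree_pCons_le)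
  also have "\<dots> = a *s v + (\<Sum>i\<le>degree p. M *v (coeff p i *s (mpow M i *v v)))"
    by (subst sum.atMost_Suc_shift)
       (simp add: matrix_vector_mul_assoc[symmetric] vector_scalar_commute)
  finally show ?thesis
    by (simp add: poly_apply_def linear_sum[OF matrix_vector_mul_linear])
qed

lemma poly_apply_matrix: "poly_apply M p (M *v v) = M *v poly_apply M p v"
proof (induction p)
  case 0
  then show ?case by (simp add: poly_apply_def)
next
  case (pCons a p)
  then show ?case
    by (simp add: poly_apply_pCons matrix_vector_right_distrib vector_scalar_commute)
qed

lemma poly_apply_diff_scale: "poly_apply M p (u - l *s v) = poly_apply M p u - l *s poly_apply M p v"
  by (simp add: poly_apply_def matrix_vector_mult_diff_distrib vector_scalar_commute
      vec_eq_iff sum_subtractf sum_distrib_left algebra_simps)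

lemma poly_apply_linear_factor:
  "poly_apply M ([:- l, 1:] * q) v = M *v poly_apply M q v - l *s poly_apply M q v"
proof -
  have eq: "[:- l, 1:] * q = pCons 0 q + smult (- l) q"
    by simp
  have "poly_apply M ([:- l, 1:] * q) v =
      (\<Sum>i\<le>Suc (degree q). coeff (pCons 0 q) i *s (mpow M i *v v)) +
      (\<Sum>i\<le>Suc (degree q). coeff (smult (- l) q) i *s (mpow M i *v v))"
    unfolding eq
    by (subst poly_apply_alt[of _ "Suc (degree q)"])
       (auto simp: sum.distrib[symmetric] vector_sadd_rdistrib
         intro!: degree_add_le degree_diff_le order_trans[OF degree_pCons_le] order_trans[OF degree_smult_le])
  also have "\<dots> = poly_apply M (pCons 0 q) v + (\<Sum>i\<le>Suc (degree q). - l *s (coeff q i *s (mpow M i *v v)))"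
    by (subst poly_apply_alt[of _ "Suc (degree q)"]) (simp_all add: degree_pCons_le)
  also have "\<dots> = M *v poly_apply M q v + - l *s (\<Sum>i\<le>Suc (degree q). coeff q i *s (mpow M i *v v))"
    by (simp only: poly_apply_pCons vec.scale_sum_right) simp
  also have "(\<Sum>i\<le>Suc (degree q). coeff q i *s (mpow M i *v v)) = poly_apply M q v"
    by (rule poly_apply_alt[symmetric]) simp
  finally show ?thesis by simp
qed

text \<open>Takes the place of Cayley-Hamilton for a single vector: more iterates of
  \<open>v\<close> than the real dimension satisfy a real linear relation, whose coefficients form
  \<open>p\<close>.\<close>

lemma poly_annihilator_exists:
  fixes M :: "complex^'n^'n"
  obtains p where "p \<noteq> 0" "poly_apply M p v = 0"
proof -
  define f where "f = (\<lambda>i. mpow M i *v v)"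
  show ?thesis
  \<comment> \<open>The iterates form a set larger than the dimension only if they are distinct; two
    equal iterates give the polynomial \<open>x^i - x^j\<close> instead.\<close>
  proof (cases "inj_on f {..DIM(complex^'n)}")
    case True
    then have "dependent (f ` {..DIM(complex^'n)})"
      by (intro dependent_biggerset) (simp add: card_image)
    then obtain u i where ui: "(\<Sum>w\<in>f ` {..DIM(complex^'n)}. u w *\<^sub>R w) = 0"
      "i \<le> DIM(complex^'n)" "u (f i) \<noteq> 0"
      by (auto simp: dependent_finite)
    define p where "p = (\<Sum>k\<le>DIM(complex^'n). monom (complex_of_real (u (f k))) k)"
    have coeff: "coeff p k = (if k \<le> DIM(complex^'n) then complex_of_real (u (f k)) else 0)" for k
      unfolding p_def coeff_sum coeff_monom by simp
    have "p \<noteq> 0"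
      using ui(2,3) coeff[of i] by auto
    moreover have "degree p \<le> DIM(complex^'n)"
      by (rule degree_le) (simp add: coeff)
    then have "poly_apply M p v = (\<Sum>k\<le>DIM(complex^'n). u (f k) *\<^sub>R f k)"
      by (simp add: poly_apply_alt coeff f_def vec_eq_iff scaleR_conv_of_real[where 'a = complex])
    then have "poly_apply M p v = 0"
      using ui(1) unfolding sum.reindex[OF True] by simp
    ultimately show ?thesis by (rule that)
  next
    case False
    then obtain i j where ij: "f i = f j" "i \<noteq> j"
      by (auto simp: inj_on_def)
    define p :: "complex poly" where "p = monom 1 i + monom (- 1) j"
    have coeff: "coeff p k = (if k = i then 1 else 0) - (if k = j then 1 else 0)" for k
      by (simp add: p_def)
    have "p \<noteq> 0"
      using coeff[of i] ij by auto
    moreover have "degree p \<le> i + j"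
      by (rule degree_le) (simp add: coeff)
    then have "poly_apply M p v = (\<Sum>k\<le>i + j. (if k = i then f k else 0) - (if k = j then f k else 0))"
      by (auto simp: poly_apply_alt coeff f_def intro!: sum.cong)
    then have "poly_apply M p v = 0"
      using ij by (simp add: sum_subtractf)
    ultimately show ?thesis by (rule that)
  qed
qed

section \<open>Decay of single orbits and of the matrix exponential\<close>

definition flow_decays :: "real^'n^'n \<Rightarrow> complex^'n \<Rightarrow> bool" where
  "flow_decays A v \<longleftrightarrow>
    (\<exists>M. \<exists>c>0. \<forall>t\<ge>0. norm (cmat (mexp (t *\<^sub>R A)) *v v) \<le> M * exp (- c * t))"

text \<open>The orbit \<open>y\<close> of \<open>v\<close> solves \<open>y' = l y + g\<close>, where
  \<open>g\<close> is the orbit of \<open>A v - l v\<close>; decay passes from \<open>g\<close> to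
  \<open>y\<close> by variation of constants.\<close>

lemma flow_decays_step:
  fixes A :: "real^'n^'n"
  assumes "flow_decays A (cmat A *v v - l *s v)" "Re l < 0"
  shows "flow_decays A v"
proof -
  define g where "g = (\<lambda>t. cmat (mexp (t *\<^sub>R A)) *v (cmat A *v v - l *s v))"
  define y where "y = (\<lambda>t. cmat (mexp (t *\<^sub>R A)) *v v)"
  obtain M c where c: "c > 0" and M: "\<And>t. t \<ge> 0 \<Longrightarrow> norm (g t) \<le> M * exp (- c * t)"
    using assms(1) unfolding flow_decays_def g_def by blast
  have M0: "M \<ge> 0"
    using M[of 0] by (auto intro: order_trans[OF norm_ge_zero])
  \<comment> \<open>The rate lies strictly below \<open>- Re l\<close>, as the comparison demands,
    and not above \<open>c\<close>, so that the bound on \<open>g\<close> persists.\<close>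
  define c' where "c' = min c (- Re l / 2)"
  have c': "0 < c'" "c' < - Re l" "c' \<le> c"
    using c assms(2) by (auto simp: c'_def min_def)
  have "norm (y t) \<le> (norm (y 0) + M / (- Re l - c')) * exp (- c' * t)" if "t \<ge> 0" for t
  proof (rule linear_decay_bound[where g = g])
    fix t :: real
    have "bounded_linear (\<lambda>X. cmat X *v v)"
      unfolding linear_conv_bounded_linear[symmetric]
      by (auto intro!: linearI simp: vec_eq_iff matrix_vector_mult_def sum.distrib
          scaleR_conv_of_real[where 'a = complex] sum_distrib_left algebra_simps)
    from bounded_linear.has_vector_derivative[OF this mexp_has_vector_derivative]
    have "(y has_vector_derivative cmat (mexp (t *\<^sub>R A) ** A) *v v) (at t)"
      unfolding y_def .
    moreover have "cmat (mexp (t *\<^sub>R A) ** A) *v v = l *s y t + g t"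
      by (simp add: y_def g_def map_matrix_of_real_mult matrix_vector_mul_assoc[symmetric]
          matrix_vector_mult_diff_distrib vector_scalar_commute)
    ultimately show "(y has_vector_derivative l *s y t + g t) (at t)"
      by simp
  next
    fix t :: real assume "t \<ge> 0"
    then have "c' * t \<le> c * t"
      using c' by (intro mult_right_mono) auto
    then have "M * exp (- c * t) \<le> M * exp (- c' * t)"
      using M0 by (intro mult_left_mono) auto
    then show "norm (g t) \<le> M * exp (- c' * t)"
      using M[OF \<open>t \<ge> 0\<close>] by linarith
  qed (use c' that in auto)
  then show ?thesis
    using c' unfolding flow_decays_def y_def by blast
qed

text \<open>
  Peel one root \<open>l\<close> off an annihilating polynomial of \<open>v\<close>: either the remaining factor already
  annihilates \<open>v\<close>, or \<open>l\<close> is an eigenvalue and the remaining factor annihilates \<open>A v - l v\<close>.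
\<close>

lemma flow_decays_annihilated:
  fixes A :: "real^'n^'n"
  assumes "hurwitz A" "p \<noteq> 0" "poly_apply (cmat A) p v = 0"
  shows "flow_decays A v"
  using assms(2,3)
proof (induction "degree p" arbitrary: p v)
  case 0
  then obtain a where "p = [:a:]" "a \<noteq> 0"
    by (metis degree_eq_zeroE pCons_0_0)
  with 0 have "v = 0"
    by (simp add: poly_apply_def)
  then show ?case
    by (auto simp: flow_decays_def intro!: exI[of _ 0] exI[of _ 1])
next
  case (Suc d)
  then have "\<not> constant (poly p)"
    by (simp add: constant_degree)
  then obtain l where "poly p l = 0"
    using fundamental_theorem_of_algebra by blast
  then obtain q where pq: "p = [:- l, 1:] * q"
    by (auto simp: poly_eq_0_iff_dvd)
  with Suc.prems have q: "q \<noteq> 0"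
    by auto
  with pq Suc.hyps(2) have dq: "d = degree q"
    by (simp add: degree_mult_eq del: mult_pCons_left)
  define w where "w = poly_apply (cmat A) q v"
  have w: "cmat A *v w = l *s w"
    using Suc.prems(2) unfolding pq poly_apply_linear_factor w_def by simp
  show ?case
  proof (cases "w = 0")
    case True
    then show ?thesis
      using Suc.hyps(1)[OF dq q] by (simp add: w_def)
  next
    case False
    then have "Re l < 0"
      using assms(1) w by (auto simp: hurwitz_def)
    moreover have "poly_apply (cmat A) q (cmat A *v v - l *s v) = 0"
      using w by (simp add: poly_apply_diff_scale poly_apply_matrix w_def)
    then have "flow_decays A (cmat A *v v - l *s v)"
      by (rule Suc.hyps(1)[OF dq q])
    ultimately show ?thesis
      by (rule flow_decays_step[rotated])
  qed
qed

text \<open>The orbits of the standard basis vectors are the columns of the exponential. They are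
  finitely many, so the least of their rates serves them all.\<close>

lemma hurwitz_mexp_bound:
  fixes A :: "real^'n^'n"
  assumes "hurwitz A"
  obtains M c where "c > 0" "\<And>t. t \<ge> 0 \<Longrightarrow> norm (mexp (t *\<^sub>R A)) \<le> M * exp (- c * t)"
proof -
  have "flow_decays A v" for v
    using poly_annihilator_exists[of "cmat A" v] flow_decays_annihilated[OF assms] by blast
  then have "\<forall>j. \<exists>M c. c > 0 \<and> (\<forall>t\<ge>0. norm (cmat (mexp (t *\<^sub>R A)) *v axis j 1) \<le> M * exp (- c * t))"
    unfolding flow_decays_def by blast
  then obtain M c where c: "\<And>j. c j > 0"
    and M: "\<And>j t. t \<ge> 0 \<Longrightarrow> norm (cmat (mexp (t *\<^sub>R A)) *v axis j 1) \<le> M j * exp (- c j * t)"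
    by metis
  define d where "d = Min (range c)"
  have d: "d > 0" "\<And>j. d \<le> c j"
    using c by (auto simp: d_def)
  have entry: "\<bar>mexp (t *\<^sub>R A) $ i $ j\<bar> \<le> \<bar>M j\<bar> * exp (- d * t)" if "t \<ge> 0" for i j t
  proof -
    have "\<bar>mexp (t *\<^sub>R A) $ i $ j\<bar> = norm ((cmat (mexp (t *\<^sub>R A)) *v axis j 1) $ i)"
      by (simp add: matrix_vector_mult_def axis_def if_distrib sum.delta cong: if_cong)
    also have "\<dots> \<le> norm (cmat (mexp (t *\<^sub>R A)) *v axis j 1)"
      by (rule Finite_Cartesian_Product.norm_nth_le)
    also have "\<dots> \<le> \<bar>M j\<bar> * exp (- c j * t)"
      using M[OF that, of j] by (rule order_trans) (auto intro: mult_right_mono)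
    also have "\<dots> \<le> \<bar>M j\<bar> * exp (- d * t)"
      using d(2)[of j] that by (intro mult_left_mono) (auto intro: mult_right_mono)
    finally show ?thesis .
  qed
  have "norm (mexp (t *\<^sub>R A)) \<le> (\<Sum>i\<in>(UNIV::'n set). \<Sum>j\<in>UNIV. \<bar>M j\<bar>) * exp (- d * t)"
    if "t \<ge> 0" for t
  proof -
    have "norm (mexp (t *\<^sub>R A)) \<le> (\<Sum>i\<in>UNIV. norm (mexp (t *\<^sub>R A) $ i))"
      by (simp add: norm_vec_def L2_set_le_sum)
    also have "\<dots> \<le> (\<Sum>i\<in>UNIV. \<Sum>j\<in>UNIV. \<bar>mexp (t *\<^sub>R A) $ i $ j\<bar>)"
      by (intro sum_mono norm_le_l1_cart)
    also have "\<dots> \<le> (\<Sum>i\<in>(UNIV::'n set). \<Sum>j\<in>UNIV. \<bar>M j\<bar> * exp (- d * t))"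
      by (intro sum_mono entry[OF that])
    finally show ?thesis
      by (simp only: sum_distrib_right)
  qed
  with d(1) show ?thesis by (rule that)
qed

subsection \<open>The Lyapunov operator and controllability\<close>

text \<open>Dominated convergence for the truncations of \<open>f\<close> to \<open>{0..k}\<close>.
  It makes the integral over the half line a limit of integrals over compact intervals, where the
  fundamental theorem of calculus applies.\<close>

lemma dominated_half_line:
  fixes f :: "real \<Rightarrow> 'a::euclidean_space"
  assumes cont: "continuous_on {0..} f" and h: "h integrable_on {0..}"
    and le: "\<And>t. t \<ge> 0 \<Longrightarrow> norm (f t) \<le> h t"
  shows "f integrable_on {0..}"
    and "(\<lambda>k. integral {0..real k} f) \<longlonglongrightarrow> integral {0..} f"
proof -
  define g where "g = (\<lambda>k t. if t \<in> {0..real k} then f t else 0)"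
  have int: "f integrable_on {0..real k}" for k
    by (intro integrable_continuous_interval continuous_on_subset[OF cont]) auto
  have sub: "{0..real k} \<inter> {0..} = {0..real k}" for k
    by auto
  have "g k integrable_on {0..}" for k
    unfolding g_def integrable_restrict_Int using int[of k] by (simp add: Int_absorb1 Int_absorb2)
  moreover have "norm (g k t) \<le> h t" if "t \<in> {0..}" for k t
    using le[of t] that by (auto simp: g_def intro: order_trans[OF norm_ge_zero])
  moreover have "(\<lambda>k. g k t) \<longlonglongrightarrow> f t" if "t \<in> {0..}" for t
  proof (rule tendsto_eventually)
    obtain N where "t \<le> real N"
      using real_arch_simple by blast
    then show "\<forall>\<^sub>F k in sequentially. g k t = f t"
      unfolding eventually_sequentially using that by (intro exI[of _ N]) (auto simp: g_def)
  qed
  ultimately have *: "f integrable_on {0..}" "(\<lambda>k. integral {0..} (g k)) \<longlonglongrightarrow> integral {0..} f"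
    using dominated_convergence[of g "{0..}" h f] h by blast+
  moreover have "integral {0..} (g k) = integral {0..real k} f" for k
    unfolding g_def integral_restrict_Int by (simp add: Int_absorb1 Int_absorb2)
  ultimately show "f integrable_on {0..}" "(\<lambda>k. integral {0..real k} f) \<longlonglongrightarrow> integral {0..} f"
    by simp_all
qed

text \<open>The integrand \<open>f V\<close> satisfies \<open>f' = L f\<close> for the Lyapunov
  operator \<open>L\<close>, so integrating \<open>L f\<close> leaves the boundary terms
  \<open>0 - V\<close>. Transposition passes under the integral and turns the integrand for
  \<open>V\<close> into that for \<open>transpose V\<close>.\<close>

lemma lyap_properties:
  fixes A V :: "real^'n^'n"
  assumes "hurwitz A"
  shows lyap_equation: "A ** lyap A V + lyap A V ** transpose A + V = 0"
    and transpose_lyap: "transpose (lyap A V) = lyap A (transpose V)"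
proof -
  define f where "f = (\<lambda>V t. mexp (t *\<^sub>R A) ** V ** mexp (t *\<^sub>R transpose A))"
  define L where "L = (\<lambda>X. A ** X + X ** transpose A)"
  interpret mul: bounded_bilinear "(**) :: real^'n^'n \<Rightarrow> real^'n^'n \<Rightarrow> real^'n^'n"
    by (rule bounded_bilinear_matrix_mul)
  have f': "(f V has_vector_derivative L (f V t)) (at t within S)" for V t S
  proof -
    note d = mexp_has_vector_derivative[of A t S] mexp_has_vector_derivative[of "transpose A" t S]
    have "(f V has_vector_derivative mexp (t *\<^sub>R A) ** V ** (mexp (t *\<^sub>R transpose A) ** transpose A)
        + mexp (t *\<^sub>R A) ** A ** V ** mexp (t *\<^sub>R transpose A)) (at t within S)"
      unfolding f_def
      by (rule mul.has_vector_derivative[OF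
          bounded_linear.has_vector_derivative[OF mul.bounded_linear_left d(1)] d(2)])
    then show ?thesis
      by (simp add: L_def f_def mexp_commute[of t A] matrix_mul_assoc add.commute)
  qed
  have cont: "continuous_on S (f V)" for S V
    using has_vector_derivative_continuous[OF f'] by (auto simp: continuous_on_eq_continuous_within)
  obtain M c where c: "c > 0" and M: "\<And>t. t \<ge> 0 \<Longrightarrow> norm (mexp (t *\<^sub>R A)) \<le> M * exp (- c * t)"
    using hurwitz_mexp_bound[OF assms] by blast
  have bound: "\<exists>N. \<forall>t\<ge>0. norm (f V t) \<le> N * exp (- (2 * c) * t)" for V
  proof -
    obtain K where "K \<ge> 0" and K: "\<And>X Y. norm ((X :: real^'n^'n) ** Y) \<le> norm X * norm (Y :: real^'n^'n) * K"
      using mul.nonneg_bounded by blast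
    obtain T where "T \<ge> 0" and T: "\<And>X. norm (transpose (X :: real^'n^'n)) \<le> norm X * T"
      using bounded_linear.nonneg_bounded[OF bounded_linear_transpose[where 'n = 'n and 'm = 'n]] by blast
    have "norm (f V t) \<le> (M * norm V * K * M * T * K) * exp (- (2 * c) * t)" if "t \<ge> 0" for t
    proof -
      let ?X = "mexp (t *\<^sub>R A)"
      have "norm (f V t) \<le> norm (?X ** V) * norm (transpose ?X) * K"
        unfolding f_def mexp_transpose by (rule K)
      also have "\<dots> \<le> (norm ?X * norm V * K) * (norm ?X * T) * K"
        using \<open>K \<ge> 0\<close> by (intro mult_right_mono mult_mono K T) auto
      also have "\<dots> \<le> ((M * exp (- c * t)) * norm V * K) * ((M * exp (- c * t)) * T) * K"
        using \<open>K \<ge> 0\<close> \<open>T \<ge> 0\<close> order_trans[OF norm_ge_zero M[OF that]]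
        by (intro mult_right_mono mult_mono M[OF that]) auto
      also have "\<dots> = (M * norm V * K * M * T * K) * (exp (- c * t) * exp (- c * t))"
        by (simp only: mult_ac)
      also have "exp (- c * t) * exp (- c * t) = exp (- (2 * c) * t)"
        by (simp add: exp_add[symmetric])
      finally show ?thesis .
    qed
    then show ?thesis by blast
  qed
  have h: "(\<lambda>t. N * exp (- (2 * c) * t)) integrable_on {0..}" for N
    using integrable_cmul[OF integrable_on_exp_minus_to_infinity[of "2 * c" 0], of N] c
    by (simp only: real_scaleR_def)
  have int: "(f V has_integral lyap A V) {0..}" for V
  proof -
    obtain N where "\<And>t. t \<ge> 0 \<Longrightarrow> norm (f V t) \<le> N * exp (- (2 * c) * t)"
      using bound[of V] by auto
    then have "f V integrable_on {0..}"
      by (rule dominated_half_line(1)[OF cont h])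
    then show ?thesis
      unfolding lyap_def f_def by (rule integrable_integral)
  qed
  have "bounded_linear L"
    unfolding L_def by (intro bounded_linear_add mul.bounded_linear_left mul.bounded_linear_right)
  obtain N where N: "\<And>t. t \<ge> 0 \<Longrightarrow> norm (f V t) \<le> N * exp (- (2 * c) * t)"
    using bound[of V] by auto
  obtain K where "K \<ge> 0" and K: "\<And>X. norm (L X) \<le> norm X * K"
    using bounded_linear.nonneg_bounded[OF \<open>bounded_linear L\<close>] by blast
  have LN: "norm (L (f V t)) \<le> (N * K) * exp (- (2 * c) * t)" if "t \<ge> 0" for t
    using order_trans[OF K mult_right_mono[OF N[OF that] \<open>K \<ge> 0\<close>]] by (simp add: mult_ac)
  \<comment> \<open>The truncated integrals are evaluated in two ways: they tend to
    \<open>L (lyap A V)\<close> because \<open>L\<close> is bounded linear, and to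
    \<open>- f V 0\<close> by the fundamental theorem and decay.\<close>
  have "(\<lambda>k. integral {0..real k} (\<lambda>t. L (f V t))) \<longlonglongrightarrow> integral {0..} (\<lambda>t. L (f V t))"
    by (rule dominated_half_line(2)[OF _ h LN])
       (intro bounded_linear.continuous_on[OF \<open>bounded_linear L\<close>] cont)
  moreover have "integral {0..} (\<lambda>t. L (f V t)) = L (lyap A V)"
    using has_integral_linear[OF int \<open>bounded_linear L\<close>] by (auto simp: o_def intro: integral_unique)
  moreover have "integral {0..real k} (\<lambda>t. L (f V t)) = f V (real k) - f V 0" for k
    by (rule integral_unique[OF fundamental_theorem_of_calculus]) (use f' in auto)
  moreover have "(\<lambda>k. f V (real k)) \<longlonglongrightarrow> 0"
  proof (rule Lim_null_comparison)
    show "\<forall>\<^sub>F k in sequentially. norm (f V (real k)) \<le> N * exp (- (2 * c) * real k)"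
      by (intro always_eventually allI N) simp
    have "filterlim (\<lambda>k. - (2 * c) * real k) at_bot sequentially"
      using c by (intro filterlim_tendsto_neg_mult_at_bot[OF tendsto_const _ filterlim_real_sequentially]) simp
    from tendsto_mult_left[OF filterlim_compose[OF exp_at_bot this], of N]
    show "(\<lambda>k. N * exp (- (2 * c) * real k)) \<longlonglongrightarrow> 0"
      by simp
  qed
  then have "(\<lambda>k. f V (real k) - f V 0) \<longlonglongrightarrow> 0 - f V 0"
    by (rule tendsto_diff[OF _ tendsto_const])
  ultimately have "L (lyap A V) = - f V 0"
    by (auto intro: LIMSEQ_unique)
  moreover have "f V 0 = V"
    using mexp_0[of A] mexp_0[of "transpose A"] by (simp add: f_def)
  ultimately show "A ** lyap A V + lyap A V ** transpose A + V = 0"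
    by (simp add: L_def)
  have "((\<lambda>t. transpose (f V t)) has_integral transpose (lyap A V)) {0..}"
    using has_integral_linear[OF int bounded_linear_transpose] by (simp add: o_def)
  moreover have "(\<lambda>t. transpose (f V t)) = f (transpose V)"
    by (simp add: f_def mexp_transpose matrix_transpose_mul matrix_mul_assoc fun_eq_iff)
  ultimately show "transpose (lyap A V) = lyap A (transpose V)"
    using has_integral_unique[OF _ int[of "transpose V"]] by simp
qed

section \<open>Controllability and invertible Lyapunov solutions\<close>

lemma controllable_kernel:
  fixes A :: "real^'n^'n" and B :: "real^'m^'n"
  assumes "controllable A B" and x: "\<And>k. transpose (mpow A k ** B) *v x = 0"
  shows "x = 0"
proof -
  have "span (\<Union>k<CARD('n). columns (mpow A k ** B)) = (UNIV :: (real^'n) set)"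
    using assms(1) by (simp add: controllable_def dim_eq_full[symmetric])
  then have "x \<in> span (\<Union>k<CARD('n). columns (mpow A k ** B))"
    by simp
  \<comment> \<open>The columns span the whole space, so orthogonality to each of them makes
    \<open>x\<close> orthogonal to itself.\<close>
  moreover have "orthogonal x y" if y: "y \<in> (\<Union>k<CARD('n). columns (mpow A k ** B))" for y
  proof -
    obtain k j where "y = column j (mpow A k ** B)"
      using y by (auto simp: columns_def)
    moreover have "(x v* (mpow A k ** B)) $ j = 0"
      using x[of k] by simp
    ultimately show ?thesis
      by (simp add: orthogonal_def vector_matrix_mult_def column_def inner_vec_def mult.commute)
  qed
  ultimately have "orthogonal x x"
    by (rule orthogonal_to_span)
  then show ?thesis
    by (simp add: orthogonal_def)
qed

text \<open>
  The kernel of \<open>X\<close> lies in the kernel of \<open>B\<^sup>T\<close> and is invariant under \<open>A\<^sup>T\<close>.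
\<close>

lemma controllable_lyap_solution_invertible:
  fixes A X :: "real^'n^'n" and B :: "real^'m^'n"
  assumes "controllable A B" and sym: "transpose X = X"
    and eq: "A ** X + X ** transpose A + B ** transpose B = 0"
  shows "invertible X"
proof -
  have step: "transpose B *v x = 0 \<and> X *v (transpose A *v x) = 0" if Xx: "X *v x = 0" for x
  proof -
    have eqx: "X *v (transpose A *v x) + B *v (transpose B *v x) = 0"
      using arg_cong[OF eq, of "\<lambda>Y. Y *v x"] Xx
      by (simp only: matrix_vector_mult_add_rdistrib matrix_vector_mul_assoc[symmetric]) simp
    \<comment> \<open>Symmetry of \<open>X\<close> moves it onto \<open>x\<close>, where it
      vanishes. Pairing the equation with \<open>x\<close> then leaves only the squared norm of
      \<open>transpose B *v x\<close>.\<close>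
    have "x \<bullet> (X *v (transpose A *v x)) = 0"
      using Xx dot_lmul_matrix[of x X "transpose A *v x"] transpose_matrix_vector[of X x] sym by simp
    then have "x \<bullet> (B *v (transpose B *v x)) = 0"
      using arg_cong[OF eqx, of "\<lambda>y. x \<bullet> y"] by (simp add: inner_add_right)
    then have "transpose B *v x = 0"
      by (simp add: dot_lmul_matrix[symmetric])
    with eqx show ?thesis by simp
  qed
  have "x = 0" if "X *v x = 0" for x
  proof -
    have "X *v (transpose (mpow A k) *v x) = 0" for k
      by (induction k)
         (use that step in \<open>simp_all add: mpow_Suc2 matrix_transpose_mul matrix_vector_mul_assoc[symmetric]
            del: transpose_matrix_vector mpow.simps(2)\<close>)
    then have "transpose (mpow A k ** B) *v x = 0" for k
      using step by (simp add: matrix_transpose_mul matrix_vector_mul_assoc[symmetric]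
          del: transpose_matrix_vector)
    then show "x = 0"
      by (rule controllable_kernel[OF assms(1)])
  qed
  then show ?thesis
    unfolding invertible_left_inverse matrix_left_invertible_ker by blast
qed

subsection \<open>The recursion\<close>

lemma matrix_inv:
  assumes "invertible X"
  shows matrix_inv_right: "X ** matrix_inv X = mat 1"
    and matrix_inv_left: "matrix_inv X ** X = mat 1"
  using someI_ex[OF assms[unfolded invertible_def]] by (simp_all add: matrix_inv_def)

lemma transpose_matrix_inv:
  fixes X :: "real^'n^'n"
  assumes "invertible X" "transpose X = X"
  shows "transpose (matrix_inv X) = matrix_inv X"
proof -
  have "transpose (matrix_inv X) ** X = mat 1"
    using arg_cong[OF matrix_inv_right[OF assms(1)], of transpose]
    by (simp add: matrix_transpose_mul assms(2))
  then have "transpose (matrix_inv X) ** (X ** matrix_inv X) = matrix_inv X"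
    by (simp add: matrix_mul_assoc)
  then show ?thesis
    by (simp add: matrix_inv_right[OF assms(1)])
qed

text \<open>Serves with \<open>D = B\<close> for \<open>\<gamma>_0\<close>, with
  \<open>D = P C^T\<close> for \<open>\<gamma>_1\<close>, and with
  \<open>D = \<gamma>_j \<rho>_j\<close> for \<open>\<gamma>_(j+1)\<close>.\<close>

lemma lyap_factor:
  fixes A :: "real^'n^'n" and D :: "real^'m^'n"
  assumes "hurwitz A" "controllable A D"
  shows "transpose (lyap A (D ** transpose D)) = lyap A (D ** transpose D)"
    and "invertible (lyap A (D ** transpose D))"
proof -
  show sym: "transpose (lyap A (D ** transpose D)) = lyap A (D ** transpose D)"
    by (simp add: transpose_lyap[OF assms(1)] matrix_transpose_mul)
  show "invertible (lyap A (D ** transpose D))"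
    by (rule controllable_lyap_solution_invertible[OF assms(2) sym lyap_equation[OF assms(1)]])
qed

text \<open>Inserting \<open>\<alpha>_(j+1) = \<gamma>_j \<beta>_j\<close> makes the argument of
  \<open>lyap\<close> symmetric; a factorisation of \<open>\<beta>_j\<close> then turns it into a
  Gramian.\<close>

lemma gamma_seq_Suc_Suc:
  "gamma_seq A B C (Suc (Suc i)) =
    lyap A (gamma_seq A B C (Suc i) ** beta_seq A B C (Suc i) ** gamma_seq A B C (Suc i))"
  by (simp del: beta_seq.simps)

text \<open>A congruence of the \<open>\<beta>\<close> two indices back by the very factor in the
  recursion for \<open>\<rho>\<close>, so the factorisation passes along indices of equal
  parity.\<close>

lemma beta_seq_Suc_Suc_Suc:
  "beta_seq A B C (Suc (Suc (Suc i))) =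
    matrix_inv (gamma_seq A B C (Suc (Suc i))) ** gamma_seq A B C (Suc i) ** beta_seq A B C (Suc i)
      ** gamma_seq A B C (Suc i) ** matrix_inv (gamma_seq A B C (Suc (Suc i)))"
  by (simp add: matrix_mul_assoc del: gamma_seq.simps)

lemma recursion_properties:
  fixes A :: "real^'n^'n" and B :: "real^'m^'n" and C :: "real^'n^'p"
  assumes A: "hurwitz A"
    and ctrl_B: "controllable A B"
    and ctrl_C: "controllable A (gramian A B ** transpose C)"
    and odd: "\<And>j. odd j \<Longrightarrow> controllable A (gamma_seq A B C j ** rho_odd A B C j)"
    and even: "\<And>j. even j \<Longrightarrow> j \<ge> 1 \<Longrightarrow> controllable A (gamma_seq A B C j ** rho_even A B C j)"
  shows "transpose (gamma_seq A B C j) = gamma_seq A B C j"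
    and "invertible (gamma_seq A B C j)"
    and "transpose (beta_seq A B C j) = beta_seq A B C j"
proof -
  let ?g = "gamma_seq A B C" and ?b = "beta_seq A B C"
  let ?\<rho> = "rho_odd A B C" and ?\<rho>' = "rho_even A B C"
  \<comment> \<open>\<open>\<gamma>_j\<close> needs the factorisation of
    \<open>\<beta>_(j-1)\<close>, and that of \<open>\<beta>_j\<close> needs
    \<open>\<beta>_(j-2)\<close>, hence one strong induction. Index 0 is left out of the even clause
    because \<open>rho_even\<close> has the dummy value 0 there while \<open>\<beta>_0\<close> is
    the identity.\<close>
  have *: "transpose (?g j) = ?g j \<and> invertible (?g j) \<and>
    (odd j \<longrightarrow> ?b j = ?\<rho> j ** transpose (?\<rho> j)) \<and>
    (even j \<and> j \<noteq> 0 \<longrightarrow> ?b j = ?\<rho>' j ** transpose (?\<rho>' j))"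
  proof (induction j rule: less_induct)
    case (less j)
    consider "j = 0" | "j = 1" | i where "j = Suc (Suc i)"
      by (metis One_nat_def not0_implies_Suc)
    then show ?case
    proof cases
      case 1
      then show ?thesis
        using lyap_factor[OF A ctrl_B] by (simp add: gramian_def)
    next
      case 2
      have P: "transpose (gramian A B) = gramian A B" "invertible (gramian A B)"
        using lyap_factor[OF A ctrl_B] by (simp_all add: gramian_def)
      \<comment> \<open>The factor \<open>\<Omega>\<close> is split between the two copies of
        \<open>P\<close>.\<close>
      have "?g 1 = lyap A ((gramian A B ** transpose C) ** transpose (gramian A B ** transpose C))"
        by (simp add: matrix_transpose_mul P matrix_mul_assoc)
      then show ?thesis
        using lyap_factor[OF A ctrl_C] 2
        by (simp add: matrix_transpose_mul matrix_mul_assoc transpose_matrix_inv P)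
    next
      case 3
      have g: "transpose (?g (Suc i)) = ?g (Suc i)" "invertible (?g (Suc i))"
        "transpose (?g i) = ?g i"
        using less.IH[of "Suc i"] less.IH[of i] 3 by (simp_all del: gamma_seq.simps)
      have gi: "transpose (matrix_inv (?g (Suc i))) = matrix_inv (?g (Suc i))"
        by (rule transpose_matrix_inv[OF g(2,1)])
      have "transpose (?g j) = ?g j \<and> invertible (?g j)"
      proof (cases "odd (Suc i)")
        case True
        with less.IH 3 have "?b (Suc i) = ?\<rho> (Suc i) ** transpose (?\<rho> (Suc i))"
          by blast
        then have "?g j = lyap A ((?g (Suc i) ** ?\<rho> (Suc i)) ** transpose (?g (Suc i) ** ?\<rho> (Suc i)))"
          unfolding 3 gamma_seq_Suc_Suc
          by (simp add: matrix_transpose_mul g matrix_mul_assoc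
              del: rho_odd.simps gamma_seq.simps beta_seq.simps)
        then show ?thesis
          using lyap_factor[OF A odd[OF True]] by simp
      next
        case False
        with less.IH 3 have "?b (Suc i) = ?\<rho>' (Suc i) ** transpose (?\<rho>' (Suc i))"
          by blast
        then have "?g j = lyap A ((?g (Suc i) ** ?\<rho>' (Suc i)) ** transpose (?g (Suc i) ** ?\<rho>' (Suc i)))"
          unfolding 3 gamma_seq_Suc_Suc
          by (simp add: matrix_transpose_mul g matrix_mul_assoc
              del: rho_even.simps gamma_seq.simps beta_seq.simps)
        then show ?thesis
          using lyap_factor[OF A even[of "Suc i"]] False by simp
      qed
      moreover have "odd j \<longrightarrow> ?b j = ?\<rho> j ** transpose (?\<rho> j)"
      proof
        assume "odd j"
        then obtain l where l: "i = Suc l" "odd i"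
          using 3 by (cases i) auto
        then have "?b i = ?\<rho> i ** transpose (?\<rho> i)"
          using less.IH[of i] 3 by auto
        then show "?b j = ?\<rho> j ** transpose (?\<rho> j)"
          using l(1) g gi unfolding 3 l(1) beta_seq_Suc_Suc_Suc rho_odd.simps(3)
          by (simp add: matrix_transpose_mul matrix_mul_assoc
              del: gamma_seq.simps beta_seq.simps rho_odd.simps)
      qed
      moreover have "even j \<and> j \<noteq> 0 \<longrightarrow> ?b j = ?\<rho>' j ** transpose (?\<rho>' j)"
      proof (cases i)
        \<comment> \<open>Here \<open>j = 2\<close>, the start of the even chain:
          \<open>\<beta>_2\<close> comes from \<open>P \<Omega> P\<close> and not from
          \<open>\<beta>_0\<close>.\<close>
        case 0
        then show ?thesis
          using g gi by (simp add: 3 matrix_transpose_mul matrix_mul_assoc)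
      next
        case (Suc l)
        show ?thesis
        proof
          assume "even j \<and> j \<noteq> 0"
          then have "even i"
            using 3 by simp
          then have "?b i = ?\<rho>' i ** transpose (?\<rho>' i)"
            using less.IH[of i] 3 Suc by simp
          then show "?b j = ?\<rho>' j ** transpose (?\<rho>' j)"
            using g gi unfolding 3 Suc beta_seq_Suc_Suc_Suc rho_even.simps(4)
            by (simp add: matrix_transpose_mul matrix_mul_assoc
                del: gamma_seq.simps beta_seq.simps rho_even.simps)
        qed
      qed
      ultimately show ?thesis by blast
    qed
  qed
  then show "transpose (?g j) = ?g j" "invertible (?g j)" by blast+
  have "j = 0 \<or> ?b j = ?\<rho> j ** transpose (?\<rho> j) \<or> ?b j = ?\<rho>' j ** transpose (?\<rho>' j)"
    using * by blast
  then show "transpose (?b j) = ?b j"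
    by (elim disjE) (simp_all add: matrix_transpose_mul)
qed

subsection \<open>Powers of the spectral density\<close>

lemma map_matrix_cmat_simps:
  "cmat (X + Y) = cmat X + cmat Y" "cmat (- X) = - cmat X" "cmat (mat 1) = mat 1"
  by (simp_all add: vec_eq_iff mat_def)

lemma adjoint_mat_mult: "adjoint_mat (X ** Y) = adjoint_mat Y ** adjoint_mat X"
  by (simp add: adjoint_mat_def vec_eq_iff matrix_matrix_mult_def transpose_def mult.commute)

lemma adjoint_mat_cmat: "adjoint_mat (cmat X) = cmat (transpose X)"
  by (simp add: adjoint_mat_def vec_eq_iff transpose_def)

lemma matrix_add_rdistrib: "(X + Y) ** Z = X ** Z + Y ** (Z :: 'a::semiring_1^'n^'m)"
  by (simp add: vec_eq_iff matrix_matrix_mult_def sum.distrib distrib_right)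

lemma matrix_diff_ldistrib: "X ** (Y - Z) = X ** Y - X ** (Z :: 'a::ring_1^'n^'m)"
  by (simp add: vec_eq_iff matrix_matrix_mult_def sum_subtractf algebra_simps)

lemma matrix_diff_rdistrib: "(X - Y) ** Z = X ** Z - Y ** (Z :: 'a::ring_1^'n^'m)"
  by (simp add: vec_eq_iff matrix_matrix_mult_def sum_subtractf algebra_simps)

lemma mat_mult_commute: "mat (a :: 'a::comm_semiring_1) ** X = X ** mat a"
  by (simp add: vec_eq_iff matrix_matrix_mult_def mat_def if_distrib if_distribR sum.delta
      mult.commute cong: if_cong)

text \<open>
  Both sides equal \<open>E X + X E'\<close>: the identities \<open>D X + X D' = V\<close> and
  \<open>Y D + D' Y = Y V Y\<close> are equivalent for \<open>Y = X\<^sup>-\<^sup>1\<close>.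
\<close>

lemma exchange_identity:
  fixes D :: "complex^'n^'n"
  assumes E: "D ** E = mat 1" "E ** D = mat 1" and E': "D' ** E' = mat 1" "E' ** D' = mat 1"
    and V: "V = D ** X + X ** D'" and Y: "X ** Y = mat 1" "Y ** X = mat 1"
  shows "E ** V ** E' = X ** E' ** (Y ** V ** Y) ** E ** X"
proof -
  have "E ** V ** E' = (E ** D) ** X ** E' + E ** X ** (D' ** E')"
    by (simp add: V matrix_add_ldistrib matrix_add_rdistrib matrix_mul_assoc)
  also have "\<dots> = X ** E' ** Y ** X + X ** Y ** E ** X"
    using Y by (simp add: E E' matrix_mul_assoc[symmetric])
  also have "\<dots> = X ** E' ** Y ** (D ** E) ** X + X ** (E' ** D') ** Y ** E ** X"
    by (simp add: E E')
  also have "\<dots> = X ** E' ** (Y ** D + D' ** Y) ** E ** X"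
    by (simp add: matrix_add_ldistrib matrix_add_rdistrib matrix_mul_assoc)
  also have "Y ** D + D' ** Y = Y ** D ** (X ** Y) + (Y ** X) ** D' ** Y"
    by (simp add: Y)
  also have "\<dots> = Y ** V ** Y"
    by (simp add: V matrix_add_ldistrib matrix_add_rdistrib matrix_mul_assoc)
  finally show ?thesis .
qed

text \<open>With \<open>D = s - A\<close> and \<open>D' = - s - A^T\<close>, the inverses of the two
  resolvents, the scalar parts cancel in \<open>D X + X D'\<close>, and the Lyapunov equation
  identifies the rest with \<open>V\<close>.\<close>

lemma resolvent_exchange:
  fixes A X V :: "real^'n^'n"
  assumes s: "invertible (mat s - cmat A)" and s': "invertible (mat (- cnj s) - cmat A)"
    and eq: "A ** X + X ** transpose A + V = 0" and X: "invertible X"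
  shows "resolvent A s ** cmat V ** sys_conj (resolvent A) s =
    cmat X ** sys_conj (resolvent A) s ** cmat (matrix_inv X ** V ** matrix_inv X) **
      resolvent A s ** cmat X"
proof -
  let ?D = "mat s - cmat A" and ?D' = "mat (- s) - cmat (transpose A)"
  have D': "?D' = adjoint_mat (mat (- cnj s) - cmat A)"
    by (simp add: adjoint_mat_def vec_eq_iff transpose_def mat_def)
  have "adjoint_mat (mat 1) = (mat 1 :: complex^'n^'n)"
    by (simp add: adjoint_mat_def vec_eq_iff transpose_def mat_def)
  then have E': "?D' ** sys_conj (resolvent A) s = mat 1" "sys_conj (resolvent A) s ** ?D' = mat 1"
    unfolding D' sys_conj_def resolvent_def adjoint_mat_mult[symmetric]
    by (simp_all only: matrix_inv[OF s'])
  have Y: "cmat X ** cmat (matrix_inv X) = mat 1" "cmat (matrix_inv X) ** cmat X = mat 1"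
    by (simp_all add: map_matrix_of_real_mult[symmetric] matrix_inv[OF X] map_matrix_cmat_simps)
  have "V = - (A ** X + X ** transpose A)"
    using eq by (simp only: eq_neg_iff_add_eq_0 add.commute)
  then have "cmat V = - (cmat A ** cmat X + cmat X ** cmat (transpose A))"
    by (simp only: map_matrix_cmat_simps map_matrix_of_real_mult)
  also have "\<dots> = ?D ** cmat X + cmat X ** ?D'"
  proof -
    have "mat s + mat (- s) = (0 :: complex^'n^'n)"
      by (simp add: vec_eq_iff mat_def)
    then have "mat s ** cmat X + cmat X ** mat (- s) = 0"
      by (simp add: mat_mult_commute[of "- s", symmetric] matrix_add_rdistrib[symmetric])
    then show ?thesis
      by (simp add: matrix_diff_ldistrib matrix_diff_rdistrib algebra_simps)
  qed
  finally have V: "cmat V = ?D ** cmat X + cmat X ** ?D'" .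
  have E: "?D ** resolvent A s = mat 1" "resolvent A s ** ?D = mat 1"
    by (simp_all add: resolvent_def matrix_inv[OF s])
  show ?thesis
    using exchange_identity[OF E E' V Y] by (simp add: map_matrix_of_real_mult)
qed

text \<open>The two invertibility hypotheses keep \<open>s\<close> away from the poles of
  \<open>E\<close> and of its conjugate, so the identity of rational functions is stated
  pointwise.\<close>

theorem theorem4:
  fixes A :: "real^'n^'n" and B :: "real^'m^'n" and C :: "real^'n^'p"
    and k :: nat and s :: complex
  assumes "hurwitz A"
    and "controllable A B"
    and "controllable A (gramian A B ** transpose C)"
    and "\<And>j. odd j \<Longrightarrow> controllable A (gamma_seq A B C j ** rho_odd A B C j)"
    and "\<And>j. even j \<Longrightarrow> j \<ge> 1 \<Longrightarrow> controllable A (gamma_seq A B C j ** rho_even A B C j)"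
    and "k \<ge> 1"
    and "invertible (mat s - cmat A)" and "invertible (mat (- cnj s) - cmat A)"
  shows "mpow (spectral_density A B C s) k =
    cmat C
      ** prod_right (\<lambda>j. cmat (transpose (alpha_seq A B C j)) ** sys_conj (resolvent A) s) k
      ** cmat (beta_seq A B C k)
      ** prod_left (\<lambda>j. resolvent A s ** cmat (alpha_seq A B C j)) k
      ** cmat (transpose C)"
proof -
  note rec = recursion_properties[OF assms(1-5)]
  let ?a = "alpha_seq A B C" and ?b = "beta_seq A B C" and ?g = "gamma_seq A B C"
  let ?\<Omega> = "\<lambda>j. if j = 1 then transpose C ** C else mat 1"
  define E where "E = resolvent A s"
  define E' where "E' = sys_conj (resolvent A) s"
  define S where "S = spectral_density A B C s"
  define L where "L = prod_left (\<lambda>j. E ** cmat (?a j))"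
  define R where "R = prod_right (\<lambda>j. cmat (transpose (?a j)) ** E')"
  note exch = resolvent_exchange[OF assms(7,8), folded E_def E'_def]
  note massoc = map_matrix_of_real_mult matrix_mul_assoc
  have S: "S = cmat C ** (E ** cmat (B ** transpose B) ** E') ** cmat (transpose C)"
    by (simp add: S_def spectral_density_def transfer_def sys_conj_def E_def E'_def
        adjoint_mat_mult adjoint_mat_cmat massoc)
  have exch0: "E ** cmat (B ** transpose B) ** E' = cmat (?g 0) ** E' ** cmat (?b 1) ** E ** cmat (?a 1)"
    using exch[of "?g 0" "B ** transpose B"] rec(2)[of 0] lyap_equation[OF assms(1)]
    by (simp add: gramian_def)
  \<comment> \<open>The middle factor produced by the exchange with
    \<open>X = \<gamma>_(i+1)\<close> is \<open>\<beta>_(i+2)\<close> by its very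
    definition.\<close>
  have exch_Suc: "E ** cmat (?a (Suc i) ** ?\<Omega> (Suc i) ** ?g i) ** E' =
      cmat (?g (Suc i)) ** E' ** cmat (?b (Suc (Suc i))) ** E ** cmat (?g (Suc i))" for i
  proof -
    have "A ** ?g (Suc i) + ?g (Suc i) ** transpose A + ?a (Suc i) ** ?\<Omega> (Suc i) ** ?g i = 0"
      using lyap_equation[OF assms(1)] by simp
    from exch[OF this rec(2)] show ?thesis
      by (simp add: matrix_mul_assoc del: gamma_seq.simps)
  qed
  \<comment> \<open>Since \<open>\<alpha>_(i+2) = \<gamma>_(i+1) \<beta>_(i+1)\<close>, the exchange
    read backwards frees \<open>E \<alpha>_(i+1)\<close> on the left and leaves the same
    configuration one index lower.\<close>
  have peel: "cmat (?\<Omega> (Suc i)) ** cmat (?g i) ** E' ** cmat (?b (Suc i)) ** L (Suc i) ** cmat (transpose C)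
      = L i ** cmat (transpose C) ** S" for i
  proof (induction i)
    case 0
    \<comment> \<open>At the bottom \<open>\<Omega> = C^T C\<close> supplies the \<open>C\<close>
      that completes a factor \<open>S\<close>.\<close>
    have "cmat (?\<Omega> (Suc 0)) ** cmat (?g 0) ** E' ** cmat (?b (Suc 0)) ** L (Suc 0) ** cmat (transpose C)
      = cmat (transpose C) ** cmat C ** (cmat (?g 0) ** E' ** cmat (?b 1) ** E ** cmat (?a 1)) ** cmat (transpose C)"
      by (simp add: L_def massoc del: beta_seq.simps alpha_seq.simps gamma_seq.simps)
    also have "\<dots> = L 0 ** cmat (transpose C) ** S"
      unfolding S exch0[symmetric] by (simp add: L_def matrix_mul_assoc)
    finally show ?case .
  next
    case (Suc i)
    have "cmat (?\<Omega> (Suc (Suc i))) ** cmat (?g (Suc i)) ** E' ** cmat (?b (Suc (Suc i))) ** L (Suc (Suc i))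
          ** cmat (transpose C)
        = (cmat (?g (Suc i)) ** E' ** cmat (?b (Suc (Suc i))) ** E ** cmat (?g (Suc i)))
          ** cmat (?b (Suc i)) ** L (Suc i) ** cmat (transpose C)"
      by (simp add: L_def massoc map_matrix_cmat_simps del: beta_seq.simps gamma_seq.simps)
    also have "\<dots> = E ** cmat (?a (Suc i)) **
        (cmat (?\<Omega> (Suc i)) ** cmat (?g i) ** E' ** cmat (?b (Suc i)) ** L (Suc i) ** cmat (transpose C))"
      unfolding exch_Suc[symmetric] by (simp only: massoc)
    also have "\<dots> = L (Suc i) ** cmat (transpose C) ** S"
      unfolding Suc.IH by (simp add: L_def matrix_mul_assoc)
    finally show ?case .
  qed
  have "mpow S (Suc i) = cmat C ** R (Suc i) ** cmat (?b (Suc i)) ** L (Suc i) ** cmat (transpose C)" for i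
  proof (induction i)
    case 0
    have "transpose (?a 1) = ?g 0"
      using rec(1)[of 0] by simp
    then show ?case
      unfolding mpow.simps matrix_mul_rid S exch0
      by (simp add: L_def R_def massoc del: beta_seq.simps alpha_seq.simps gamma_seq.simps)
  next
    case (Suc i)
    \<comment> \<open>The transposed factor breaks at the right place: \<open>\<beta>_(i+1)\<close>
      closes the formula for the previous power, and \<open>\<gamma>_(i+1)\<close> opens the
      expression to be peeled.\<close>
    have "transpose (?a (Suc (Suc i))) = ?b (Suc i) ** ?g (Suc i)"
      by (simp add: matrix_transpose_mul rec del: beta_seq.simps gamma_seq.simps)
    then have "cmat C ** R (Suc (Suc i)) ** cmat (?b (Suc (Suc i))) ** L (Suc (Suc i)) ** cmat (transpose C)
      = cmat C ** R (Suc i) ** cmat (?b (Suc i)) ** (cmat (?\<Omega> (Suc (Suc i))) ** cmat (?g (Suc i)) ** E'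
          ** cmat (?b (Suc (Suc i))) ** L (Suc (Suc i)) ** cmat (transpose C))"
      by (simp add: R_def massoc map_matrix_cmat_simps
          del: beta_seq.simps alpha_seq.simps gamma_seq.simps)
    also have "\<dots> = mpow S (Suc i) ** S"
      unfolding peel Suc.IH by (simp only: matrix_mul_assoc)
    finally show ?case
      by (simp only: mpow_Suc2[of S "Suc i"])
  qed
  \<comment> \<open>The induction starts at exponent 1; at exponent 0 the right-hand side would be
    \<open>C C^T\<close>.\<close>
  from this[of "k - 1"] assms(6) show ?thesis
    by (simp add: S_def R_def L_def E_def E'_def)
qed

end
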